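(* Let $K\ge1$ and $\beta>K^{-1}$. Then $$\sup_f\int_0^{2\pi}\exp\left(\beta|f^\star(e^{i\theta})|^2\right)d\theta=\infty,$$ where the supremum is taken over all $K$-quasiregular mappings $f:\mathbb{B}^2\to\mathbb{R}^2$ with $f(0)=0$ and $\int_{\mathbb{B}^2}J(x,f)\,dx\le\pi$, and $f^\star(\zeta)=\lim_{t\uparrow1}f(t\zeta)$ for a.e. $\zeta\in\partial\mathbb{B}^2$.
   Context: $\mathbb{B}^2$ is the open unit disk in $\mathbb{R}^2=\mathbb{C}$. For an open set $\Omega\subset\mathbb{R}^2$ and $K\ge1$, a mapping $f:\Omega\to\mathbb{R}^2$ is called $K$-quasiregular if it belongs to the Sobolev class $W^{1,2}_{loc}(\Omega,\mathbb{R}^2)$ and satisfies $\|Df(x)\|^2\le K J(x,f)$ for almost every $x\in\Omega$, where $\|Df(x)\|$ is the operator norm of the derivative matrix $Df(x)$ and $J(x,f)=\det Df(x)$. Quasiregular mappings are continuous (i.e. taken to be the continuous representative). It is a known fact that a quasiregular mapping $f:\mathbb{B}^2\to\mathbb{R}^2$ with $\int_{\mathbb{B}^2}J(x,f)\,dx\le\pi$ has radial limits at almost every point of the unit circle, so $f^\star$ is well defined. *)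

theory Defs
  imports "HOL-Analysis.Analysis"
begin

definition partial_derivative :: "'n::finite \<Rightarrow> (real^'n \<Rightarrow> real) \<Rightarrow> real^'n \<Rightarrow> real" where
  "partial_derivative j \<phi> x = frechet_derivative \<phi> (at x) (axis j 1)"

fun C_k :: "nat \<Rightarrow> (real^'n::finite \<Rightarrow> real) \<Rightarrow> bool" where
  "C_k 0 \<phi> \<longleftrightarrow> continuous_on UNIV \<phi>"
| "C_k (Suc k) \<phi> \<longleftrightarrow> \<phi> differentiable_on UNIV \<and> (\<forall>j. C_k k (partial_derivative j \<phi>))"

definition test_function :: "(real^'n::finite) set \<Rightarrow> (real^'n \<Rightarrow> real) \<Rightarrow> bool" where
  "test_function \<Omega> \<phi> \<longleftrightarrow>
     (\<forall>k. C_k k \<phi>) \<and>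
     compact (closure {x. \<phi> x \<noteq> 0}) \<and> closure {x. \<phi> x \<noteq> 0} \<subseteq> \<Omega>"

definition L2_loc :: "(real^'n::finite) set \<Rightarrow> (real^'n \<Rightarrow> 'b::euclidean_space) \<Rightarrow> bool" where
  "L2_loc \<Omega> f \<longleftrightarrow>
     f \<in> borel_measurable (lebesgue_on \<Omega>) \<and>
     (\<forall>C. compact C \<and> C \<subseteq> \<Omega> \<longrightarrow> set_integrable lebesgue C (\<lambda>x. (norm (f x))\<^sup>2))"

text \<open>
  \<open>W12_loc_deriv \<Omega> f Df\<close> says that \<open>f\<close> belongs to the Sobolev class
  \<open>W\<^sup>1\<^sup>,\<^sup>2\<^sub>l\<^sub>o\<^sub>c(\<Omega>)\<close> and that \<open>Df\<close> is its matrix of weak partial derivatives, the entry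
  \<open>Df x $ i $ j\<close> being the derivative of the component \<open>f\<^sub>i\<close> in direction \<open>j\<close>. On an open
  set \<open>\<Omega>\<close> the matrix field \<open>Df\<close> is determined by \<open>f\<close> up to a null set.
\<close>

definition W12_loc_deriv ::
    "(real^'n::finite) set \<Rightarrow> (real^'n \<Rightarrow> real^'m::finite) \<Rightarrow> (real^'n \<Rightarrow> real^'n^'m) \<Rightarrow> bool" where
  "W12_loc_deriv \<Omega> f Df \<longleftrightarrow>
     L2_loc \<Omega> f \<and> L2_loc \<Omega> Df \<and>
     (\<forall>\<phi> i j. test_function \<Omega> \<phi> \<longrightarrow>
        (LINT x:\<Omega>|lebesgue. f x $ i * partial_derivative j \<phi> x) =
        - (LINT x:\<Omega>|lebesgue. Df x $ i $ j * \<phi> x))"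

text \<open>Continuity selects the continuous representative of the Sobolev function.\<close>

definition quasiregular :: "real \<Rightarrow> (real^2) set \<Rightarrow> (real^2 \<Rightarrow> real^2) \<Rightarrow> bool" where
  "quasiregular K \<Omega> f \<longleftrightarrow>
     continuous_on \<Omega> f \<and>
     (\<exists>Df. W12_loc_deriv \<Omega> f Df \<and>
           (AE x\<in>\<Omega> in lebesgue. (onorm (\<lambda>v. Df x *v v))\<^sup>2 \<le> K * det (Df x)))"

text \<open>
  The Jacobian of a quasiregular mapping is nonnegative almost everywhere, so its integral is
  the extended nonnegative one; in particular a non-integrable Jacobian is not admitted below.
\<close>

definition jacobian_integral_le :: "(real^2) set \<Rightarrow> (real^2 \<Rightarrow> real^2) \<Rightarrow> real \<Rightarrow> bool" where
  "jacobian_integral_le \<Omega> f c \<longleftrightarrow>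
     (\<exists>Df. W12_loc_deriv \<Omega> f Df \<and> (\<integral>\<^sup>+x\<in>\<Omega>. ennreal (det (Df x)) \<partial>lebesgue) \<le> ennreal c)"

text \<open>The value is unspecified at points where the radial limit does not exist.\<close>

definition radial_limit :: "(real^2 \<Rightarrow> real^2) \<Rightarrow> real^2 \<Rightarrow> real^2" where
  "radial_limit f \<zeta> = Lim (at_left 1) (\<lambda>t. f (t *\<^sub>R \<zeta>))"

definition circle_point :: "real \<Rightarrow> real^2" where
  "circle_point \<theta> = vector [cos \<theta>, sin \<theta>]"

end

theory Submission
  imports Defs
begin

text \<open>
  For \<open>K = 1\<close> the extremal examples are Beurling's: for \<open>a\<close> close to \<open>1\<close> the conformal map
  \<open>w = - Ln (1 - a z)\<close> sends the disk into the rectangle \<open>- ln 2 \<le> Re w \<le> L\<close>,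
  \<open>\<bar>Im w\<bar> < pi / 2\<close>, where \<open>L = - ln (1 - a)\<close>. Being injective, it has image area at most
  \<open>pi (L + ln 2)\<close>, so dividing it by \<open>sqrt (L + ln 2)\<close> brings the area down to at most \<open>pi\<close>.
  On a boundary arc of length about \<open>1 - a = exp (- L)\<close> next to the point \<open>1\<close> one has
  \<open>Re w \<ge> L - ln 2\<close>, hence the squared modulus of the normalized map is there about \<open>L\<close>.

  For general \<open>K\<close>, note that the image is long and thin in the real direction, and
  that the modulus on the arc comes from the real part alone. Following the conformal map by the
  linear map \<open>(x, y) \<mapsto> (sqrt K x, y / sqrt K)\<close>, which preserves area and has distortion \<open>K\<close>,
  therefore costs nothing in the area and multiplies the squared modulus on the arc by \<open>K\<close>.
  The exponential integral over the arc is then at least of the order of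
  \<open>exp (\<beta> K L) exp (- L)\<close>, which is unbounded as \<open>L\<close> tends to infinity because \<open>\<beta> K > 1\<close>; the precise
  bound is \<open>boundary_integral_stretched_log_ge\<close>, and \<open>stretched_log_admissible\<close> is the
  verification that these maps compete in the supremum.

  The maps are smooth across the unit circle, so that radial limits are values. They are Sobolev
  maps because the classical derivative of a \<open>C\<^sup>1\<close> map is its weak derivative
  (\<open>W12_loc_deriv_C1\<close>), which rests on the vanishing of the integral of a directional derivative
  of a compactly supported function.
\<close>

section \<open>Weak derivatives of continuously differentiable maps\<close>

text \<open>
  By translation invariance every difference quotient in the direction \<open>e\<close> has integral \<open>0\<close>, and
  the quotients converge boundedly, with supports in a common ball, to the directional derivative.
  This treats all directions in all dimensions at once, without iterated integrals.
\<close>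

lemma integral_directional_derivative_eq_0:
  fixes \<psi> :: "'a::euclidean_space \<Rightarrow> real" and e :: 'a
  assumes der: "\<And>x. (\<psi> has_derivative \<psi>' x) (at x)"
    and cont: "continuous_on UNIV (\<lambda>x. \<psi>' x e)"
    and S: "compact S" and zero: "\<And>x. x \<notin> S \<Longrightarrow> \<psi> x = 0"
  shows "(\<integral>x. \<psi>' x e \<partial>lborel) = 0"
proof -
  define q where "q n x = real (Suc n) * (\<psi> (x + (1 / real (Suc n)) *\<^sub>R e) - \<psi> x)" for n x
  have cont_\<psi>: "continuous_on UNIV \<psi>"
    using der has_derivative_continuous continuous_at_imp_continuous_on by blast
  have [measurable]: "\<psi> \<in> borel_measurable borel"
    using cont_\<psi> by (rule borel_measurable_continuous_onI)
  have [measurable]: "(\<lambda>x. \<psi>' x e) \<in> borel_measurable borel"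
    using cont by (rule borel_measurable_continuous_onI)
  have zero': "\<psi>' x e = 0" if "x \<notin> S" for x
  proof -
    have "((\<lambda>_. 0) has_derivative \<psi>' x) (at x)"
      using that zero
      by (intro has_derivative_transform_within_open[OF der[of x] open_Compl[OF compact_imp_closed[OF S]]]) auto
    then show ?thesis
      using has_derivative_unique[OF has_derivative_const] by (metis (no_types))
  qed
  have "bounded ((\<lambda>x. \<psi>' x e) ` S)"
    using S cont by (intro compact_imp_bounded compact_continuous_image) (auto intro: continuous_on_subset)
  then obtain M0 where M0: "\<And>x. x \<in> S \<Longrightarrow> \<bar>\<psi>' x e\<bar> \<le> M0"
    by (auto simp: bounded_iff)
  define M where "M = max 0 M0"
  have M: "\<bar>\<psi>' x e\<bar> \<le> M" for x
    using M0[of x] zero'[of x] by (cases "x \<in> S") (auto simp: M_def)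
  obtain R where R: "\<And>x. x \<in> S \<Longrightarrow> norm x \<le> R"
    using compact_imp_bounded[OF S] by (auto simp: bounded_iff)
  have line: "((\<lambda>t. \<psi> (x + t *\<^sub>R e)) has_real_derivative \<psi>' (x + t *\<^sub>R e) e) (at t)" for x t
  proof -
    have "((\<lambda>t. \<psi> (x + t *\<^sub>R e)) has_derivative (\<lambda>s. \<psi>' (x + t *\<^sub>R e) (s *\<^sub>R e))) (at t)"
      by (rule has_derivative_compose[OF _ der]) (auto intro!: derivative_eq_intros)
    moreover have "(\<lambda>s. \<psi>' (x + t *\<^sub>R e) (s *\<^sub>R e)) = (*) (\<psi>' (x + t *\<^sub>R e) e)"
      using linear_cmul[OF has_derivative_linear[OF der]] by (auto simp: fun_eq_iff)
    ultimately show ?thesis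
      by (simp add: has_field_derivative_def)
  qed
  have q_bound: "\<bar>q n x\<bar> \<le> M * indicator (cball 0 (R + norm e)) x" for n x
  proof (cases "x \<in> cball 0 (R + norm e)")
    case True
    obtain z where z: "\<psi> (x + (1 / real (Suc n)) *\<^sub>R e) - \<psi> (x + 0 *\<^sub>R e)
        = (1 / real (Suc n) - 0) * \<psi>' (x + z *\<^sub>R e) e"
      using MVT2[of 0 "1 / real (Suc n)" "\<lambda>t. \<psi> (x + t *\<^sub>R e)" "\<lambda>t. \<psi>' (x + t *\<^sub>R e) e"] line
      by auto
    then have "q n x = \<psi>' (x + z *\<^sub>R e) e"
      by (simp add: q_def)
    then show ?thesis
      using M True by simp
  next
    case False
    then have n: "norm x > R + norm e" by simp
    have "norm ((1 / real (Suc n)) *\<^sub>R e) \<le> norm e"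
      using mult_right_mono[of "1 / real (Suc n)" 1 "norm e"] by simp
    then have "norm (x + (1 / real (Suc n)) *\<^sub>R e) > R"
      using n norm_diff_ineq[of x "(1 / real (Suc n)) *\<^sub>R e"] by linarith
    moreover have "norm x > R"
      using n norm_ge_zero[of e] by linarith
    ultimately have "\<psi> (x + (1 / real (Suc n)) *\<^sub>R e) = 0" "\<psi> x = 0"
      using R zero by (meson not_le)+
    then show ?thesis
      using False by (simp add: q_def)
  qed
  have q_lim: "(\<lambda>n. q n x) \<longlonglongrightarrow> \<psi>' x e" for x
  proof -
    have "((\<lambda>h. (\<psi> (x + h *\<^sub>R e) - \<psi> x) / h) \<longlongrightarrow> \<psi>' x e) (at 0)"
      using line[of x 0] by (simp add: DERIV_def)
    moreover have "filterlim (\<lambda>n. 1 / real (Suc n)) (at 0) sequentially"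
      by (intro filterlim_atI) (use LIMSEQ_inverse_real_of_nat in \<open>auto simp: inverse_eq_divide\<close>)
    ultimately have "(\<lambda>n. (\<psi> (x + (1 / real (Suc n)) *\<^sub>R e) - \<psi> x) / (1 / real (Suc n))) \<longlonglongrightarrow> \<psi>' x e"
      by (rule filterlim_compose)
    then show ?thesis
      by (simp add: q_def mult.commute)
  qed
  have int_\<psi>: "integrable lborel \<psi>"
  proof -
    have "integrable lborel (\<lambda>x. indicator S x *\<^sub>R \<psi> x)"
      using S cont_\<psi> by (intro borel_integrable_compact) (auto intro: continuous_on_subset)
    moreover have "(\<lambda>x. indicator S x *\<^sub>R \<psi> x) = \<psi>"
      using zero by (auto simp: fun_eq_iff indicator_def)
    ultimately show ?thesis by simp
  qed
  have q_int: "(\<integral>x. q n x \<partial>lborel) = 0" for n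
  proof -
    define h where "h = (1 / real (Suc n)) *\<^sub>R e"
    have "(\<integral>x. \<psi> (h + x) \<partial>lborel) = (\<integral>x. \<psi> x \<partial>distr lborel borel ((+) h))"
      by (simp add: integral_distr)
    moreover have "integrable (distr lborel borel ((+) h)) \<psi> \<longleftrightarrow> integrable lborel (\<lambda>x. \<psi> (h + x))"
      by (simp add: integrable_distr_eq)
    ultimately have "(\<integral>x. \<psi> (h + x) \<partial>lborel) = (\<integral>x. \<psi> x \<partial>lborel)"
        "integrable lborel (\<lambda>x. \<psi> (h + x))"
      using int_\<psi> by (simp_all add: lborel_distr_plus)
    then show ?thesis
      using int_\<psi> by (simp add: q_def h_def add.commute)
  qed
  have "(\<lambda>n. \<integral>x. q n x \<partial>lborel) \<longlonglongrightarrow> (\<integral>x. \<psi>' x e \<partial>lborel)"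
  proof (rule integral_dominated_convergence[where w = "\<lambda>x. M * indicator (cball 0 (R + norm e)) x"])
    show "integrable lborel (\<lambda>x::'a. M * indicator (cball 0 (R + norm e)) x)"
      using emeasure_lborel_cball_finite[of "0::'a" "R + norm e"]
      by (intro integrable_mult_right integrable_real_indicator) auto
    show "q n \<in> borel_measurable lborel" for n
      unfolding q_def by measurable
  qed (use q_lim q_bound in auto)
  then show ?thesis
    by (simp add: q_int LIMSEQ_const_iff)
qed

lemma L2_loc_continuous:
  assumes "open \<Omega>" "continuous_on \<Omega> f"
  shows "L2_loc \<Omega> f"
  unfolding L2_loc_def
proof (intro conjI allI impI)
  show "f \<in> borel_measurable (lebesgue_on \<Omega>)"
    using assms by (intro continuous_imp_measurable_on_sets_lebesgue) auto
  fix C assume C: "compact C \<and> C \<subseteq> \<Omega>"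
  have "integrable lborel (\<lambda>x. indicator C x *\<^sub>R (norm (f x))\<^sup>2)"
    using C assms by (intro borel_integrable_compact continuous_intros) (auto intro: continuous_on_subset)
  then show "set_integrable lebesgue C (\<lambda>x. (norm (f x))\<^sup>2)"
    unfolding set_integrable_def by (subst integrable_completion) auto
qed

text \<open>
  The product \<open>u \<phi>\<close>, extended by \<open>0\<close> outside \<open>\<Omega>\<close>, is differentiable on the whole space since
  \<open>\<Omega>\<close> and the complement of the support of \<open>\<phi>\<close> form an open cover of it.
\<close>

lemma integration_by_parts_test_function:
  fixes u :: "real^'n::finite \<Rightarrow> real"
  assumes \<Omega>: "open \<Omega>"
    and der: "\<And>x. x \<in> \<Omega> \<Longrightarrow> (u has_derivative u' x) (at x)"
    and cont: "continuous_on \<Omega> (\<lambda>x. u' x (axis j 1))"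
    and \<phi>: "test_function \<Omega> \<phi>"
  shows "(LINT x:\<Omega>|lebesgue. u x * partial_derivative j \<phi> x) =
         - (LINT x:\<Omega>|lebesgue. u' x (axis j 1) * \<phi> x)"
proof -
  define e where "e = (axis j 1 :: real^'n)"
  define S where "S = closure {x. \<phi> x \<noteq> 0}"
  define \<phi>' where "\<phi>' x = frechet_derivative \<phi> (at x)" for x
  define \<psi> where "\<psi> x = (if x \<in> \<Omega> then u x * \<phi> x else 0)" for x
  define \<psi>' where "\<psi>' x v = (if x \<in> \<Omega> then u x * \<phi>' x v + u' x v * \<phi> x else 0)" for x v
  have S: "compact S" "S \<subseteq> \<Omega>" and C: "\<And>k. C_k k \<phi>"
    using \<phi> by (auto simp: test_function_def S_def)
  have der_\<phi>: "(\<phi> has_derivative \<phi>' x) (at x)" for x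
    using C[of 1] unfolding \<phi>'_def
    by (auto simp: differentiable_on_def frechet_derivative_works[symmetric])
  have cont_\<phi>: "continuous_on UNIV \<phi>"
    using C[of 0] by simp
  have cont_\<phi>': "continuous_on UNIV (\<lambda>x. \<phi>' x e)"
    using C[of 1] unfolding \<phi>'_def e_def by (simp add: partial_derivative_def)
  have \<phi>_zero: "\<phi> x = 0" if "x \<notin> S" for x
    using that closure_subset[of "{x. \<phi> x \<noteq> 0}"] by (auto simp: S_def)
  have open_S: "open (- S)"
    using S(1) by (simp add: compact_imp_closed open_Compl)
  have \<phi>'_zero: "\<phi>' x v = 0" if "x \<notin> S" for x v
  proof -
    have "((\<lambda>_. 0) has_derivative \<phi>' x) (at x)"
      using that \<phi>_zero
      by (intro has_derivative_transform_within_open[OF der_\<phi>[of x] open_S]) auto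
    then show ?thesis
      using has_derivative_unique[OF has_derivative_const] by (metis (no_types))
  qed
  have cover: "x \<in> \<Omega> \<or> x \<in> - S" for x
    using S by auto
  have cont_u: "continuous_on \<Omega> u"
    using der has_derivative_continuous continuous_at_imp_continuous_on by blast
  have der_\<psi>: "(\<psi> has_derivative \<psi>' x) (at x)" for x
    using cover[of x]
  proof
    assume x: "x \<in> \<Omega>"
    have "((\<lambda>x. u x * \<phi> x) has_derivative \<psi>' x) (at x)"
      using has_derivative_mult[OF der[OF x] der_\<phi>[of x]] x by (simp add: \<psi>'_def[abs_def])
    then show ?thesis
      by (rule has_derivative_transform_within_open[OF _ \<Omega> x]) (simp add: \<psi>_def)
  next
    assume x: "x \<in> - S"
    have "\<psi>' x = (\<lambda>_. 0)"
      using x \<phi>'_zero \<phi>_zero by (auto simp: \<psi>'_def)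
    then show ?thesis
      using x \<phi>_zero
      by (auto intro!: has_derivative_transform_within_open[OF has_derivative_const open_S] simp: \<psi>_def)
  qed
  have cont_ext: "continuous_on UNIV (\<lambda>x. if x \<in> \<Omega> then g x else 0)"
    if g: "continuous_on \<Omega> g" "\<And>x. x \<notin> S \<Longrightarrow> g x = 0" for g :: "real^'n \<Rightarrow> real"
  proof -
    have "continuous_on (\<Omega> \<union> - S) (\<lambda>x. if x \<in> \<Omega> then g x else 0)"
    proof (rule continuous_on_open_Un[OF \<Omega> open_S])
      show "continuous_on \<Omega> (\<lambda>x. if x \<in> \<Omega> then g x else 0)"
        using g(1) by (rule continuous_on_eq) simp
      show "continuous_on (- S) (\<lambda>x. if x \<in> \<Omega> then g x else 0)"
        by (rule continuous_on_eq[OF continuous_on_const[of _ 0]]) (auto simp: g(2))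
    qed
    moreover have "\<Omega> \<union> - S = UNIV"
      using cover by auto
    ultimately show ?thesis by simp
  qed
  have int: "(LINT x:\<Omega>|lebesgue. g x) = (\<integral>x. (if x \<in> \<Omega> then g x else 0) \<partial>lborel)
      \<and> integrable lborel (\<lambda>x. if x \<in> \<Omega> then g x else 0)"
    if g: "continuous_on \<Omega> g" "\<And>x. x \<notin> S \<Longrightarrow> g x = 0" for g :: "real^'n \<Rightarrow> real"
  proof
    let ?g = "\<lambda>x. if x \<in> \<Omega> then g x else 0"
    have eq: "(\<lambda>x. indicator \<Omega> x *\<^sub>R g x) = ?g" "(\<lambda>x. indicator S x *\<^sub>R ?g x) = ?g"
      using g(2) by (auto simp: indicator_def fun_eq_iff)
    have m: "?g \<in> borel_measurable lborel"
      using cont_ext[OF g] by (simp add: borel_measurable_continuous_onI)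
    show "(LINT x:\<Omega>|lebesgue. g x) = (\<integral>x. ?g x \<partial>lborel)"
      unfolding set_lebesgue_integral_def eq(1) using m by (rule integral_completion)
    show "integrable lborel ?g"
      using borel_integrable_compact[OF S(1) continuous_on_subset[OF cont_ext[OF g] subset_UNIV]]
      unfolding eq(2) .
  qed
  have c1: "continuous_on \<Omega> (\<lambda>x. u x * \<phi>' x e)"
    using cont_u continuous_on_subset[OF cont_\<phi>' subset_UNIV] by (rule continuous_on_mult)
  have c2: "continuous_on \<Omega> (\<lambda>x. u' x e * \<phi> x)"
    using cont[folded e_def] continuous_on_subset[OF cont_\<phi> subset_UNIV] by (rule continuous_on_mult)
  have i1: "(LINT x:\<Omega>|lebesgue. u x * \<phi>' x e) = (\<integral>x. (if x \<in> \<Omega> then u x * \<phi>' x e else 0) \<partial>lborel)"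
      "integrable lborel (\<lambda>x. if x \<in> \<Omega> then u x * \<phi>' x e else 0)"
    using int[OF c1] \<phi>'_zero by auto
  have i2: "(LINT x:\<Omega>|lebesgue. u' x e * \<phi> x) = (\<integral>x. (if x \<in> \<Omega> then u' x e * \<phi> x else 0) \<partial>lborel)"
      "integrable lborel (\<lambda>x. if x \<in> \<Omega> then u' x e * \<phi> x else 0)"
    using int[OF c2] \<phi>_zero by auto
  have "(\<integral>x. \<psi>' x e \<partial>lborel) = 0"
  proof (rule integral_directional_derivative_eq_0[OF der_\<psi> _ S(1)])
    show "continuous_on UNIV (\<lambda>x. \<psi>' x e)"
      unfolding \<psi>'_def
      by (rule cont_ext) (use c1 c2 \<phi>_zero \<phi>'_zero in \<open>auto intro!: continuous_on_add\<close>)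
    show "\<psi> x = 0" if "x \<notin> S" for x
      using that \<phi>_zero by (simp add: \<psi>_def)
  qed
  also have "(\<lambda>x. \<psi>' x e) = (\<lambda>x. (if x \<in> \<Omega> then u x * \<phi>' x e else 0) + (if x \<in> \<Omega> then u' x e * \<phi> x else 0))"
    by (auto simp: \<psi>'_def)
  finally have "(LINT x:\<Omega>|lebesgue. u x * \<phi>' x e) + (LINT x:\<Omega>|lebesgue. u' x e * \<phi> x) = 0"
    unfolding i1(1) i2(1) using i1(2) i2(2) by simp
  then show ?thesis
    by (simp add: partial_derivative_def \<phi>'_def e_def)
qed

lemma W12_loc_deriv_C1:
  fixes f :: "real^'n::finite \<Rightarrow> real^'m::finite"
  assumes \<Omega>: "open \<Omega>"
    and der: "\<And>x. x \<in> \<Omega> \<Longrightarrow> (f has_derivative (\<lambda>v. Df x *v v)) (at x)"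
    and cont: "continuous_on \<Omega> Df"
  shows "W12_loc_deriv \<Omega> f Df"
  unfolding W12_loc_deriv_def
proof (intro conjI allI impI)
  have "continuous_on \<Omega> f"
    using der has_derivative_continuous continuous_at_imp_continuous_on by blast
  then show "L2_loc \<Omega> f" "L2_loc \<Omega> Df"
    using \<Omega> cont by (simp_all add: L2_loc_continuous)
  fix \<phi> :: "real^'n \<Rightarrow> real" and i j assume \<phi>: "test_function \<Omega> \<phi>"
  have *: "(Df x *v axis j 1) $ i = Df x $ i $ j" for x
    by (simp add: matrix_vector_mult_basis column_def)
  have "((\<lambda>x. f x $ i) has_derivative (\<lambda>v. (Df x *v v) $ i)) (at x)" if "x \<in> \<Omega>" for x
    using bounded_linear.has_derivative[OF bounded_linear_vec_nth der[OF that]] .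
  then show "(LINT x:\<Omega>|lebesgue. f x $ i * partial_derivative j \<phi> x) =
        - (LINT x:\<Omega>|lebesgue. Df x $ i $ j * \<phi> x)"
    using integration_by_parts_test_function[OF \<Omega> _ _ \<phi>, of "\<lambda>x. f x $ i" "\<lambda>x v. (Df x *v v) $ i" j]
      continuous_on_component[OF continuous_on_component[OF cont]]
    by (simp add: *)
qed

section \<open>The area formula as an upper bound\<close>

text \<open>
  The integral of the Jacobian of an injective map is the measure of the image; a box containing
  the image gives both the finiteness and the bound.
\<close>

lemma nn_integral_det_injective_le:
  fixes f :: "real^'n::{finite,wellorder} \<Rightarrow> real^'n::_"
  assumes S: "S \<in> sets lebesgue"
    and der: "\<And>x. x \<in> S \<Longrightarrow> (f has_derivative (\<lambda>v. Df x *v v)) (at x)"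
    and inj: "inj_on f S"
    and det: "\<And>x. x \<in> S \<Longrightarrow> det (Df x) \<ge> 0"
    and image: "f ` S \<subseteq> cbox a b"
  shows "(\<integral>\<^sup>+x\<in>S. ennreal (det (Df x)) \<partial>lebesgue) \<le> ennreal (measure lborel (cbox a b))"
proof -
  have der': "(f has_derivative (\<lambda>v. Df x *v v)) (at x within S)" if "x \<in> S" for x
    using der[OF that] by (rule has_derivative_at_withinI)
  have "f ` S \<in> sets lebesgue"
    using der' by (intro differentiable_image_in_sets_lebesgue S)
      (auto simp: differentiable_on_def differentiable_def)
  then have meas: "f ` S \<in> lmeasurable"
    using image bounded_subset[OF bounded_cbox] by (intro bounded_set_imp_lmeasurable) auto
  have int: "(\<lambda>x. \<bar>det (Df x)\<bar>) integrable_on S"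
    using measurable_differentiable_image_eq[OF S der' inj] meas by simp
  then have "((\<lambda>x. \<bar>det (Df x)\<bar>) has_integral measure lebesgue (f ` S)) S"
    using measure_differentiable_image_eq[OF S der' inj] by (simp add: integrable_integral)
  then have "(\<integral>\<^sup>+x\<in>S. ennreal \<bar>det (Df x)\<bar> \<partial>lborel) = ennreal (measure lebesgue (f ` S))"
    by (intro nn_integral_has_integral_lebesgue') auto
  moreover have "(\<integral>\<^sup>+x\<in>S. ennreal (det (Df x)) \<partial>lebesgue) = (\<integral>\<^sup>+x\<in>S. ennreal \<bar>det (Df x)\<bar> \<partial>lborel)"
    unfolding nn_integral_completion
    using det by (intro nn_integral_cong) (auto simp: indicator_def)
  moreover have "measure lebesgue (f ` S) \<le> measure lebesgue (cbox a b)"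
    using image meas by (intro measure_mono_fmeasurable) auto
  ultimately show ?thesis
    by (simp add: ennreal_leI)
qed

section \<open>Stretched holomorphic maps\<close>

definition to_complex :: "real^2 \<Rightarrow> complex" where
  "to_complex x = Complex (x $ 1) (x $ 2)"

definition stretch :: "real \<Rightarrow> real \<Rightarrow> complex \<Rightarrow> real^2" where
  "stretch s t w = vector [s * Re w, t * Im w]"

text \<open>
  The matrix of \<open>stretch s t\<close> composed with multiplication by \<open>w\<close>; with \<open>w = g' z\<close> the
  Cauchy-Riemann equations make it the Jacobian matrix of \<open>stretch s t \<circ> g\<close> at \<open>z\<close>.
\<close>

definition stretch_jacobian :: "real \<Rightarrow> real \<Rightarrow> complex \<Rightarrow> real^2^2" where
  "stretch_jacobian s t w = vector [vector [s * Re w, - s * Im w], vector [t * Im w, t * Re w]]"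

lemma norm_vec2_power2: "(norm (x :: real^2))\<^sup>2 = (x $ 1)\<^sup>2 + (x $ 2)\<^sup>2"
  by (simp add: norm_vec_def L2_set_def sum_2 sum_nonneg)

lemma norm_to_complex [simp]: "norm (to_complex x) = norm x"
  by (metis norm_vec2_power2 to_complex_def cmod_power2 complex.sel norm_ge_zero power2_eq_iff_nonneg)

lemma bounded_linear_to_complex: "bounded_linear to_complex"
  unfolding linear_conv_bounded_linear[symmetric]
  by (rule linearI) (auto simp: to_complex_def complex_eq_iff)

lemma inj_to_complex: "inj to_complex"
  by (auto simp: inj_def to_complex_def vec_eq_iff forall_2)

lemma bounded_linear_stretch: "bounded_linear (stretch s t)"
  unfolding linear_conv_bounded_linear[symmetric]
  by (rule linearI) (auto simp: stretch_def vec_eq_iff forall_2 algebra_simps)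

lemma stretch_jacobian_mult: "stretch_jacobian s t w *v v = stretch s t (w * to_complex v)"
  by (simp add: stretch_def stretch_jacobian_def to_complex_def vec_eq_iff forall_2
      matrix_vector_mult_def sum_2 algebra_simps)

lemma det_stretch_jacobian: "det (stretch_jacobian s t w) = s * t * (cmod w)\<^sup>2"
  unfolding cmod_power2 by (simp add: det_2 stretch_jacobian_def algebra_simps power2_eq_square)

lemma norm_stretch_le:
  assumes "0 \<le> t" "t \<le> s"
  shows "norm (stretch s t w) \<le> s * cmod w"
proof (rule power2_le_imp_le)
  have "t\<^sup>2 * (Im w)\<^sup>2 \<le> s\<^sup>2 * (Im w)\<^sup>2"
    using assms by (intro mult_right_mono power_mono) auto
  then show "(norm (stretch s t w))\<^sup>2 \<le> (s * cmod w)\<^sup>2"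
    by (simp add: norm_vec2_power2 stretch_def power_mult_distrib cmod_power2 algebra_simps)
qed (use assms in simp)

lemma has_derivative_stretch_holomorphic:
  assumes "(g has_field_derivative w) (at (to_complex x))"
  shows "((\<lambda>x. stretch s t (g (to_complex x))) has_derivative (\<lambda>v. stretch_jacobian s t w *v v)) (at x)"
proof -
  have "((\<lambda>x. g (to_complex x)) has_derivative (\<lambda>v. w * to_complex v)) (at x)"
    using has_derivative_compose[OF bounded_linear_imp_has_derivative[OF bounded_linear_to_complex]]
      assms by (simp add: has_field_derivative_def)
  then show ?thesis
    unfolding stretch_jacobian_mult by (rule bounded_linear.has_derivative[OF bounded_linear_stretch])
qed

lemma continuous_on_stretch_jacobian:
  assumes "continuous_on \<Omega> h"
  shows "continuous_on \<Omega> (\<lambda>x. stretch_jacobian s t (h x))"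
proof -
  have "continuous_on \<Omega> (\<lambda>x. stretch_jacobian s t (h x) $ i $ j)" for i j
    using exhaust_2[of i] exhaust_2[of j] assms
    by (elim disjE; simp add: stretch_jacobian_def; intro continuous_intros)
  then have "continuous_on \<Omega> (\<lambda>x. \<chi> i j. stretch_jacobian s t (h x) $ i $ j)"
    by (intro continuous_on_vec_lambda)
  then show ?thesis
    by simp
qed

text \<open>
  For \<open>s = K t\<close> the operator norm is at most \<open>s \<bar>g'\<bar>\<close> and the determinant is \<open>s t \<bar>g'\<bar>\<^sup>2\<close>,
  so the squared norm is at most \<open>s / t = K\<close> times the determinant. The matrix of weak
  derivatives is part of the conclusion because the area of the image is computed from it.
\<close>

lemma stretch_holomorphic_quasiregular:
  assumes K: "K \<ge> 1" and t: "t \<ge> 0"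
    and \<Omega>: "open \<Omega>"
    and der: "\<And>x. x \<in> \<Omega> \<Longrightarrow> (g has_field_derivative g' (to_complex x)) (at (to_complex x))"
    and cont: "continuous_on \<Omega> (\<lambda>x. g' (to_complex x))"
  defines "f \<equiv> \<lambda>x. stretch (K * t) t (g (to_complex x))"
  shows "W12_loc_deriv \<Omega> f (\<lambda>x. stretch_jacobian (K * t) t (g' (to_complex x)))"
    and "quasiregular K \<Omega> f"
proof -
  let ?D = "\<lambda>x. stretch_jacobian (K * t) t (g' (to_complex x))"
  have f: "(f has_derivative (\<lambda>v. ?D x *v v)) (at x)" if "x \<in> \<Omega>" for x
    unfolding f_def by (rule has_derivative_stretch_holomorphic[OF der[OF that]])
  show W: "W12_loc_deriv \<Omega> f ?D"
    by (rule W12_loc_deriv_C1[OF \<Omega> f continuous_on_stretch_jacobian[OF cont]])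
  have dist: "(onorm (\<lambda>v. ?D x *v v))\<^sup>2 \<le> K * det (?D x)" for x
  proof -
    have "t \<le> K * t"
      using K t by (simp add: mult_le_cancel_right1)
    then have "norm (?D x *v v) \<le> K * t * cmod (g' (to_complex x)) * norm v" for v
      using norm_stretch_le[of t "K * t" "g' (to_complex x) * to_complex v"] t
      by (simp add: stretch_jacobian_mult norm_mult mult.assoc)
    then have "onorm (\<lambda>v. ?D x *v v) \<le> K * t * cmod (g' (to_complex x))"
      by (intro onorm_bound) (use K t in auto)
    then have "(onorm (\<lambda>v. ?D x *v v))\<^sup>2 \<le> (K * t * cmod (g' (to_complex x)))\<^sup>2"
      by (intro power_mono onorm_pos_le) auto
    then show ?thesis
      by (simp add: det_stretch_jacobian power_mult_distrib power2_eq_square algebra_simps)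
  qed
  have "continuous_on \<Omega> f"
    using f has_derivative_continuous continuous_at_imp_continuous_on by blast
  then show "quasiregular K \<Omega> f"
    unfolding quasiregular_def using W dist by auto
qed

section \<open>The logarithmic map onto a long thin domain\<close>

definition log_map :: "real \<Rightarrow> complex \<Rightarrow> complex" where
  "log_map a z = - Ln (1 - of_real a * z)"

context
  fixes a :: real
  assumes a: "0 < a" "a < 1"
begin

text \<open>
  The disk of the points \<open>1 - a z\<close> with \<open>\<bar>z\<bar> \<le> 1\<close> lies in the right half plane. This keeps it away from the branch
  cut of \<open>Ln\<close> and confines the imaginary part of the logarithm to an interval of length \<open>pi\<close>.
\<close>

lemma Re_one_minus_pos:
  assumes "cmod z \<le> 1"
  shows "0 < Re (1 - of_real a * z)"
proof -
  have "a * Re z \<le> a * 1"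
    using assms complex_Re_le_cmod[of z] a by (intro mult_left_mono) auto
  then have "a * Re z < 1"
    using a by linarith
  then show ?thesis
    by simp
qed

lemma log_map_has_field_derivative:
  assumes "cmod z \<le> 1"
  shows "(log_map a has_field_derivative of_real a / (1 - of_real a * z)) (at z)"
proof -
  have "1 - of_real a * z \<notin> \<real>\<^sub>\<le>\<^sub>0"
    using Re_one_minus_pos[OF assms] by (auto simp: complex_nonpos_Reals_iff)
  then show ?thesis
    unfolding log_map_def[abs_def]
    by (auto intro!: derivative_eq_intros simp: divide_simps)
qed

lemma inj_on_log_map: "inj_on (log_map a) (cball 0 1)"
proof (rule inj_onI)
  fix z w assume z: "z \<in> cball 0 1" and w: "w \<in> cball 0 1" and eq: "log_map a z = log_map a w"
  then have "1 - of_real a * z \<noteq> 0" "1 - of_real a * w \<noteq> 0"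
    using Re_one_minus_pos[of z] Re_one_minus_pos[of w] by force+
  then have "1 - of_real a * z = 1 - of_real a * w"
    using eq by (metis exp_Ln log_map_def neg_equal_iff_equal)
  then show "z = w"
    using a by simp
qed

lemma log_map_image:
  assumes "cmod z \<le> 1"
  shows "Re (log_map a z) \<in> {- ln 2 .. - ln (1 - a)}" "\<bar>Im (log_map a z)\<bar> < pi / 2"
proof -
  have pos: "0 < Re (1 - of_real a * z)"
    using assms by (rule Re_one_minus_pos)
  then have nz: "1 - of_real a * z \<noteq> 0"
    by force
  have az: "cmod (of_real a * z) \<le> a"
    using assms a by (simp add: norm_mult mult_left_le)
  have "cmod (1 - of_real a * z) \<le> 2"
    using norm_triangle_ineq4[of 1 "of_real a * z"] az a by simp
  moreover have "1 - a \<le> cmod (1 - of_real a * z)"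
    using norm_triangle_ineq2[of 1 "of_real a * z"] az by simp
  ultimately show "Re (log_map a z) \<in> {- ln 2 .. - ln (1 - a)}"
    using nz a by (simp add: log_map_def)
  show "\<bar>Im (log_map a z)\<bar> < pi / 2"
    using Re_Ln_pos_lt_imp[OF pos] by (simp add: log_map_def)
qed

text \<open>
  On an arc of length \<open>1 - a\<close> the distance from \<open>1 - a e\<^sup>i\<^sup>\<theta>\<close> to \<open>0\<close> is at most twice its minimal
  value \<open>1 - a\<close>, so the real part of the logarithm is within \<open>ln 2\<close> of its maximum.
\<close>

lemma log_map_near_1:
  assumes "0 \<le> \<theta>" "\<theta> \<le> 1 - a"
  shows "Re (log_map a (to_complex (circle_point \<theta>))) \<ge> - ln (1 - a) - ln 2"
proof -
  let ?z = "to_complex (circle_point \<theta>)"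
  have z: "?z = cis \<theta>"
    by (simp add: to_complex_def circle_point_def cis.code)
  have nz: "1 - of_real a * ?z \<noteq> 0"
    using Re_one_minus_pos[of ?z] unfolding z by force
  have "cmod (1 - cis \<theta>) \<le> \<theta>"
    using dist_exp_i_1[of \<theta>] abs_sin_x_le_abs_x[of "\<theta> / 2"] assms
    by (simp add: cis_conv_exp norm_minus_commute)
  then have "cmod (of_real (1 - a) + of_real a * (1 - ?z)) \<le> (1 - a) + a * \<theta>"
    using a by (intro norm_triangle_mono) (auto simp: norm_mult z simp del: of_real_diff)
  also have "\<dots> \<le> (1 - a) + 1 * (1 - a)"
    using assms a by (intro add_left_mono mult_mono) auto
  finally have "cmod (1 - of_real a * ?z) \<le> 2 * (1 - a)"
    by (simp add: algebra_simps)
  then have "ln (cmod (1 - of_real a * ?z)) \<le> ln (2 * (1 - a))"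
    using nz by (simp add: a)
  also have "\<dots> = ln 2 + ln (1 - a)"
    using a by (subst ln_mult) auto
  finally show ?thesis
    using nz by (simp add: log_map_def)
qed

end

section \<open>The extremal family\<close>

text \<open>
  The factors \<open>K t\<close> and \<open>t\<close> have quotient \<open>K\<close>, and their product \<open>1 / (ln 2 - ln (1 - a))\<close> is
  chosen so that the rectangle of dimensions \<open>ln 2 - ln (1 - a)\<close> and \<open>pi\<close> that contains the
  image of \<open>log_map a\<close> is mapped to a rectangle of area \<open>pi\<close>.
\<close>

definition stretched_log :: "real \<Rightarrow> real \<Rightarrow> real^2 \<Rightarrow> real^2" where
  "stretched_log K a =
     (let t = 1 / sqrt (K * (ln 2 - ln (1 - a)))
      in (\<lambda>x. stretch (K * t) t (log_map a (to_complex x))))"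

lemma stretched_log_admissible:
  assumes K: "K \<ge> 1" and a: "0 < a" "a < 1"
  shows "quasiregular K (ball 0 1) (stretched_log K a)"
    and "stretched_log K a 0 = 0"
    and "jacobian_integral_le (ball 0 1) (stretched_log K a) pi"
proof -
  define L where "L = - ln (1 - a)"
  define t where "t = 1 / sqrt (K * (ln 2 - ln (1 - a)))"
  have L: "0 < L"
    using a by (simp add: L_def)
  have l2: "0 < ln (2::real)"
    by simp
  have pos: "0 < K * (ln 2 + L)"
    using K L l2 by (intro mult_pos_pos add_pos_pos) auto
  have t_eq: "t = 1 / sqrt (K * (ln 2 + L))"
    by (simp add: t_def L_def)
  have t: "t > 0"
    using pos by (simp add: t_eq)
  have "t * t = 1 / (K * (ln 2 + L))"
    using pos by (simp add: t_eq)
  then have t2: "K * t * t * (L + ln 2) = 1"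
    using pos by (auto simp: divide_simps algebra_simps)
  have f: "stretched_log K a = (\<lambda>x. stretch (K * t) t (log_map a (to_complex x)))"
    by (simp add: stretched_log_def t_def)
  define g' where "g' z = of_real a / (1 - of_real a * z)" for z :: complex
  have der: "(log_map a has_field_derivative g' (to_complex x)) (at (to_complex x))"
    if "x \<in> ball 0 1" for x
    using log_map_has_field_derivative[OF a, of "to_complex x"] that by (simp add: g'_def)
  have cont: "continuous_on (ball 0 1) (\<lambda>x. g' (to_complex x))"
    unfolding g'_def
  proof (intro continuous_intros bounded_linear.continuous_on[OF bounded_linear_to_complex] ballI)
    fix x :: "real^2" assume "x \<in> ball 0 1"
    then show "1 - of_real a * to_complex x \<noteq> 0"
      using Re_one_minus_pos[OF a, of "to_complex x"] by force
  qed
  note * = stretch_holomorphic_quasiregular[OF K less_imp_le[OF t] open_ball der cont, folded f]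
  show "quasiregular K (ball 0 1) (stretched_log K a)"
    by (rule *)
  show "stretched_log K a 0 = 0"
    unfolding f by (simp add: stretch_def log_map_def to_complex_def vec_eq_iff forall_2
        zero_complex.code[symmetric])
  let ?D = "\<lambda>x. stretch_jacobian (K * t) t (g' (to_complex x))"
  let ?lo = "vector [- (K * t * ln 2), - (t * (pi / 2))] :: real^2"
  let ?hi = "vector [K * t * L, t * (pi / 2)] :: real^2"
  have "(\<integral>\<^sup>+x\<in>ball 0 1. ennreal (det (?D x)) \<partial>lebesgue) \<le> ennreal (measure lborel (cbox ?lo ?hi))"
  proof (rule nn_integral_det_injective_le)
    show "(stretched_log K a has_derivative (\<lambda>v. ?D x *v v)) (at x)" if "x \<in> ball 0 1" for x
      unfolding f by (rule has_derivative_stretch_holomorphic[OF der[OF that]])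
    show "inj_on (stretched_log K a) (ball 0 1)"
    proof (rule inj_onI)
      fix x y assume x: "x \<in> ball 0 1" and y: "y \<in> ball 0 1"
        and eq: "stretched_log K a x = stretched_log K a y"
      from eq have "log_map a (to_complex x) = log_map a (to_complex y)"
        using K t by (simp add: f stretch_def vec_eq_iff forall_2 complex_eq_iff)
      then have "to_complex x = to_complex y"
        using inj_on_log_map[OF a] x y by (auto simp: inj_on_def)
      then show "x = y"
        using inj_to_complex by (simp add: inj_def)
    qed
    show "det (?D x) \<ge> 0" for x
      using K t by (simp add: det_stretch_jacobian)
    show "stretched_log K a ` ball 0 1 \<subseteq> cbox ?lo ?hi"
      unfolding f
    proof (rule image_subsetI)
      fix x :: "real^2" assume "x \<in> ball 0 1"
      then have *: "- ln 2 \<le> Re (log_map a (to_complex x))" "Re (log_map a (to_complex x)) \<le> L"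
        "- (pi / 2) \<le> Im (log_map a (to_complex x))" "Im (log_map a (to_complex x)) \<le> pi / 2"
        using log_map_image[OF a, of "to_complex x"] by (auto simp: L_def)
      have "K * t * - ln 2 \<le> K * t * Re (log_map a (to_complex x))"
        "K * t * Re (log_map a (to_complex x)) \<le> K * t * L"
        "t * - (pi / 2) \<le> t * Im (log_map a (to_complex x))"
        "t * Im (log_map a (to_complex x)) \<le> t * (pi / 2)"
        using * K t by (intro mult_left_mono; simp)+
      then show "stretch (K * t) t (log_map a (to_complex x)) \<in> cbox ?lo ?hi"
        by (simp add: mem_box_cart forall_2 stretch_def)
    qed
  qed auto
  also have "measure lborel (cbox ?lo ?hi) = pi"
  proof -
    have "0 \<le> K * t * ln 2" "0 \<le> K * t * L"
      using K t L by auto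
    then have "?lo \<in> cbox ?lo ?hi"
      using t by (simp add: mem_box_cart forall_2)
    then have "measure lborel (cbox ?lo ?hi) = (K * t * L + K * t * ln 2) * (t * pi)"
      by (subst content_cbox_cart) (auto simp: UNIV_2 algebra_simps)
    also have "\<dots> = (K * t * t * (L + ln 2)) * pi"
      by (simp add: algebra_simps)
    finally show ?thesis
      using t2 by simp
  qed
  finally show "jacobian_integral_le (ball 0 1) (stretched_log K a) pi"
    using * unfolding jacobian_integral_le_def by blast
qed

text \<open>
  The maps are differentiable on the closed disk, in particular continuous at the boundary points.
\<close>

lemma radial_limit_stretched_log:
  assumes "0 < a" "a < 1"
  shows "radial_limit (stretched_log K a) (circle_point \<theta>) = stretched_log K a (circle_point \<theta>)"
proof -
  let ?\<zeta> = "circle_point \<theta>"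
  have norm: "norm ?\<zeta> = 1"
    using norm_vec2_power2[of ?\<zeta>] by (simp add: circle_point_def power2_eq_1_iff)
      (smt (verit) norm_ge_zero)
  have "isCont (stretched_log K a) ?\<zeta>"
    unfolding stretched_log_def Let_def
    by (rule has_derivative_continuous[OF has_derivative_stretch_holomorphic
          [OF log_map_has_field_derivative[OF assms]]]) (simp add: norm)
  moreover have "((\<lambda>t. t *\<^sub>R ?\<zeta>) \<longlongrightarrow> ?\<zeta>) (at_left 1)"
    by (auto intro!: tendsto_eq_intros)
  ultimately have "((\<lambda>t. stretched_log K a (t *\<^sub>R ?\<zeta>)) \<longlongrightarrow> stretched_log K a ?\<zeta>) (at_left 1)"
    by (rule isCont_tendsto_compose)
  then show ?thesis
    unfolding radial_limit_def by (intro tendsto_Lim) auto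
qed

text \<open>
  On the arc \<open>0 \<le> \<theta> \<le> exp (- L)\<close> the squared modulus is at least
  \<open>K (L - ln 2)\<^sup>2 / (L + ln 2)\<close>, and this is at least \<open>K (L - 3 ln 2)\<close>. Linearizing in this way
  makes the exponent an affine function of \<open>L\<close> with slope \<open>\<beta> K - 1\<close>, the quantity whose sign
  decides the theorem.
\<close>

lemma boundary_integral_stretched_log_ge:
  assumes K: "K \<ge> 1" and \<beta>: "\<beta> \<ge> 0" and L: "L \<ge> ln 2"
  shows "ennreal (exp ((\<beta> * K - 1) * L - 3 * \<beta> * K * ln 2)) \<le>
    (\<integral>\<^sup>+\<theta>\<in>{0..2*pi}. ennreal (exp (\<beta> *
       (norm (radial_limit (stretched_log K (1 - exp (- L))) (circle_point \<theta>)))\<^sup>2)) \<partial>lebesgue)"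
    (is "_ \<le> ?I")
proof -
  let ?a = "1 - exp (- L)"
  define t where "t = 1 / sqrt (K * (ln 2 + L))"
  define E where "E = exp (\<beta> * K * (L - 3 * ln 2))"
  have l2: "0 < ln (2::real)"
    by simp
  have Lpos: "0 < L"
    using L l2 by linarith
  have a: "0 < ?a" "?a < 1"
    using Lpos by auto
  have t2: "(K * t)\<^sup>2 = K / (L + ln 2)"
    using K Lpos l2 by (simp add: t_def power_mult_distrib power_divide add.commute power2_eq_square)
  have large: "E \<le> exp (\<beta> * (norm (radial_limit (stretched_log K ?a) (circle_point \<theta>)))\<^sup>2)"
    if \<theta>: "\<theta> \<in> {0..exp (- L)}" for \<theta>
  proof -
    let ?w = "log_map ?a (to_complex (circle_point \<theta>))"
    have f: "stretched_log K ?a (circle_point \<theta>) = stretch (K * t) t ?w"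
      by (simp add: stretched_log_def t_def)
    have "L - ln 2 \<le> Re ?w"
      using log_map_near_1[OF a, of \<theta>] \<theta> by simp
    then have "(L - ln 2)\<^sup>2 \<le> (Re ?w)\<^sup>2"
      using L by (intro power_mono) auto
    then have "(K * t)\<^sup>2 * (L - ln 2)\<^sup>2 \<le> (K * t)\<^sup>2 * (Re ?w)\<^sup>2"
      by (intro mult_left_mono) auto
    also have "\<dots> \<le> (norm (stretch (K * t) t ?w))\<^sup>2"
      by (simp add: norm_vec2_power2 stretch_def power_mult_distrib)
    finally have "K * ((L - ln 2)\<^sup>2 / (L + ln 2)) \<le> (norm (stretch (K * t) t ?w))\<^sup>2"
      by (simp add: t2)
    moreover have "(L - 3 * ln 2) * (L + ln 2) \<le> (L - ln 2)\<^sup>2"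
      by (simp add: power2_eq_square algebra_simps)
    then have "L - 3 * ln 2 \<le> (L - ln 2)\<^sup>2 / (L + ln 2)"
      using Lpos l2 by (simp add: pos_le_divide_eq del: ln_gt_zero_iff)
    then have "K * (L - 3 * ln 2) \<le> K * ((L - ln 2)\<^sup>2 / (L + ln 2))"
      using K by (intro mult_left_mono) auto
    ultimately have "\<beta> * (K * (L - 3 * ln 2)) \<le> \<beta> * (norm (stretch (K * t) t ?w))\<^sup>2"
      using \<beta> by (intro mult_left_mono) auto
    then show ?thesis
      unfolding E_def radial_limit_stretched_log[OF a] f by (simp add: mult.assoc)
  qed
  have "exp (- L) \<le> 1"
    using Lpos by simp
  then have "exp (- L) \<le> 2 * pi"
    using pi_gt3 by linarith
  then have sub: "{0..exp (- L)} \<subseteq> {0..2*pi}"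
    by auto
  have "ennreal (exp ((\<beta> * K - 1) * L - 3 * \<beta> * K * ln 2)) = ennreal E * ennreal (exp (- L))"
    by (simp add: E_def ennreal_mult[symmetric] exp_add[symmetric] algebra_simps)
  also have "\<dots> = (\<integral>\<^sup>+\<theta>. ennreal E * indicator {0..exp (- L)} \<theta> \<partial>lebesgue)"
    by (subst nn_integral_cmult_indicator) auto
  also have "\<dots> \<le> ?I"
    using large sub by (intro nn_integral_mono) (auto simp: indicator_def intro!: ennreal_leI)
  finally show ?thesis .
qed

theorem mainTheorem6:
  fixes K \<beta> :: real
  assumes "K \<ge> 1" and "\<beta> > inverse K"
  shows "(SUP f \<in> {f. quasiregular K (ball 0 1) f \<and> f 0 = 0 \<and>
                      jacobian_integral_le (ball 0 1) f pi}.
            \<integral>\<^sup>+\<theta>\<in>{0..2*pi}.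
              ennreal (exp (\<beta> * (norm (radial_limit f (circle_point \<theta>)))\<^sup>2)) \<partial>lebesgue) = \<infinity>"
    (is "(SUP f \<in> ?A. ?I f) = _")
proof -
  have \<beta>: "\<beta> > 0" and b: "\<beta> * K > 1"
    using assms by (auto simp: field_simps intro: less_trans[of 0 "inverse K"])
  have "\<exists>f\<in>?A. of_nat n \<le> ?I f" for n :: nat
  proof -
    \<comment> \<open>The value at which the exponent of the lower bound equals \<open>n\<close>, raised to \<open>ln 2\<close> if it is
      smaller.\<close>
    define L where "L = max (ln 2) ((real n + 3 * \<beta> * K * ln 2) / (\<beta> * K - 1))"
    have "real n + 3 * \<beta> * K * ln 2 \<le> L * (\<beta> * K - 1)"
      using b by (simp add: L_def pos_divide_le_eq[symmetric])
    then have "real n \<le> (\<beta> * K - 1) * L - 3 * \<beta> * K * ln 2"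
      by (simp add: algebra_simps)
    then have "real n \<le> exp ((\<beta> * K - 1) * L - 3 * \<beta> * K * ln 2)"
      using exp_ge_add_one_self[of "(\<beta> * K - 1) * L - 3 * \<beta> * K * ln 2"] by linarith
    moreover have "L \<ge> ln 2"
      by (simp add: L_def)
    ultimately have L: "L \<ge> ln 2" "real n \<le> exp ((\<beta> * K - 1) * L - 3 * \<beta> * K * ln 2)"
      by auto
    let ?a = "1 - exp (- L)"
    have "0 < L"
      using L(1) ln_gt_zero[of "2::real"] by linarith
    then have a: "0 < ?a" "?a < 1"
      by auto
    have "of_nat n \<le> ennreal (exp ((\<beta> * K - 1) * L - 3 * \<beta> * K * ln 2))"
      using L(2) by (simp add: ennreal_of_nat_eq_real_of_nat ennreal_leI)
    also have "\<dots> \<le> ?I (stretched_log K ?a)"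
      using boundary_integral_stretched_log_ge[OF assms(1) less_imp_le[OF \<beta>] L(1)] .
    finally show ?thesis
      using stretched_log_admissible[OF assms(1) a] by blast
  qed
  then show ?thesis
    unfolding infinity_ennreal_def by (intro ennreal_SUP_eq_top) auto
qed

end
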